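(* Let $\mathbf A$ be an integral FL${}_{\mathrm e}$-algebra, let $\delta\colon A\to A$ be an increasing map (i.e. $x\leq\delta(x)$ for all $x$), and let ${\Rightarrow}$ be a binary operation on $A$ with $(x\to y)\cdot(y\to\delta(x))\leq x{\Rightarrow} y\leq (x\to y)\wedge(y\to\delta(x))$ for all $x,y\in A$. Then $(\mathbf A,{\Rightarrow})$ is proto-connexive and ${\Rightarrow}$ is symmetric on $A$ (i.e. $x{\Rightarrow} y=y{\Rightarrow} x$ for all $x,y$) if and only if $\delta(x)=\neg\neg x$ for all $x\in A$ and $\mathbf A$ is a Boolean algebra (i.e. satisfies $x\cdot y=x\wedge y$ and $x\to y=\neg x\vee y$).
   Context: An FL${}_{\mathrm e}$-algebra is an algebra $\langle A,\wedge,\vee,\cdot,\to,0,1\rangle$ such that $\langle A,\wedge,\vee\rangle$ is a lattice (with order $\leq$), $\langle A,\cdot,1\rangle$ is a commutative monoid, $0$ is an arbitrary constant, and $x\cdot y\leq z\iff x\leq y\to z$; it is integral if $1$ is the greatest element. Write $\neg x:=x\to 0$. $(\mathbf A,{\Rightarrow})$ is proto-connexive if for all $x,y\in A$: $1\leq\neg(x{\Rightarrow}\neg x)$, $1\leq\neg(\neg x{\Rightarrow} x)$, $1\leq (x{\Rightarrow} y){\Rightarrow}\neg(x{\Rightarrow}\neg y)$, $1\leq (x{\Rightarrow}\neg y){\Rightarrow}\neg(x{\Rightarrow} y)$. *)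

theory Defs
  imports Main
begin

(* The class zero is purely syntactic, so 0 is an arbitrary constant: it is not
   assumed to be the least element or to be absorbing for multiplication. *)
class fle_algebra = lattice + comm_monoid_mult + zero +
  fixes residual :: "'a \<Rightarrow> 'a \<Rightarrow> 'a"  (infixr "\<rightarrow>\<^sub>e" 60)
  assumes residuation: "x * y \<le> z \<longleftrightarrow> x \<le> y \<rightarrow>\<^sub>e z"

class integral_fle_algebra = fle_algebra +
  assumes le_one: "x \<le> 1"

definition fle_neg :: "'a::fle_algebra \<Rightarrow> 'a"  ("\<not>\<^sub>e _" [75] 75)
  where "\<not>\<^sub>e x = x \<rightarrow>\<^sub>e 0"

definition proto_connexive :: "('a::fle_algebra \<Rightarrow> 'a \<Rightarrow> 'a) \<Rightarrow> bool"
  where "proto_connexive imp \<longleftrightarrow>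
    (\<forall>x. 1 \<le> \<not>\<^sub>e (imp x (\<not>\<^sub>e x))) \<and>
    (\<forall>x. 1 \<le> \<not>\<^sub>e (imp (\<not>\<^sub>e x) x)) \<and>
    (\<forall>x y. 1 \<le> imp (imp x y) (\<not>\<^sub>e (imp x (\<not>\<^sub>e y)))) \<and>
    (\<forall>x y. 1 \<le> imp (imp x (\<not>\<^sub>e y)) (\<not>\<^sub>e (imp x y)))"

end

theory Submission
  imports Defs
begin

text \<open>
  Since \<open>1 \<Rightarrow> y = y\<close> and \<open>y \<Rightarrow> 1 = \<delta> y\<close>, symmetry forces \<open>\<delta>\<close> to be the
  identity. The third connexive law at \<open>x = 1\<close> then gives \<open>\<not>\<not>y = y\<close>, so \<open>0\<close> is the least
  element. The first law excludes nontrivial \<open>z\<close> with \<open>z \<cdot> z = 0\<close>: such a \<open>z\<close> satisfies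
  \<open>z \<le> \<not>z\<close>, hence \<open>\<not>(\<not>z \<cdot> \<not>z) = \<not>z \<rightarrow> z \<le> z \<Rightarrow> \<not>z \<le> 0\<close> and \<open>\<not>z = 1\<close>.
  Applied to \<open>z = x \<and> \<not>x\<close> this yields complements, and complements give idempotence.
  Conversely, in a Boolean algebra \<open>\<Rightarrow>\<close> is the biconditional.
\<close>

lemma fle_mult_mono:
  fixes a b c d :: "'a::fle_algebra"
  assumes "a \<le> b" and "c \<le> d"
  shows "a * c \<le> b * d"
proof -
  have "b \<le> c \<rightarrow>\<^sub>e b * c"
    by (simp flip: residuation)
  with assms(1) have "a * c \<le> b * c"
    by (meson order_trans residuation)
  moreover have "d \<le> b \<rightarrow>\<^sub>e b * d"
    by (simp add: mult.commute flip: residuation)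
  with assms(2) have "c * b \<le> b * d"
    by (meson order_trans residuation)
  ultimately show ?thesis
    by (simp add: mult.commute)
qed

lemma fle_mult_residual_le:
  fixes x y :: "'a::fle_algebra"
  shows "(x \<rightarrow>\<^sub>e y) * x \<le> y"
  by (simp add: residuation)

lemma one_residual [simp]:
  fixes y :: "'a::fle_algebra"
  shows "1 \<rightarrow>\<^sub>e y = y"
  by (metis dual_order.antisym mult_1_right order_refl residuation)

lemma one_le_residual_iff:
  fixes x y :: "'a::fle_algebra"
  shows "1 \<le> x \<rightarrow>\<^sub>e y \<longleftrightarrow> x \<le> y"
  by (simp flip: residuation)

text \<open>Multiplication by \<open>a\<close> is a left adjoint, so it preserves joins. With
  \<open>sup b c = 1\<close> this becomes a case distinction for bounding \<open>a\<close>.\<close>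

lemma fle_mult_sup_le:
  fixes a b c d :: "'a::fle_algebra"
  assumes "a * b \<le> d" and "a * c \<le> d"
  shows "a * sup b c \<le> d"
  by (metis assms le_sup_iff mult.commute residuation)

lemma integral_one_le_iff [simp]:
  fixes x :: "'a::integral_fle_algebra"
  shows "1 \<le> x \<longleftrightarrow> x = 1"
  by (simp add: le_one order.eq_iff)

lemma integral_mult_le:
  fixes x y :: "'a::integral_fle_algebra"
  shows "x * y \<le> x" and "x * y \<le> y"
  using fle_mult_mono[OF order_refl[of x] le_one[of y]]
    fle_mult_mono[OF le_one[of x] order_refl[of y]] by simp_all

lemma integral_residual_eq_one_iff:
  fixes x y :: "'a::integral_fle_algebra"
  shows "x \<rightarrow>\<^sub>e y = 1 \<longleftrightarrow> x \<le> y"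
  using one_le_residual_iff[of x y] by simp

text \<open>Squaring the lower bound \<open>inf x y\<close> puts one copy below each factor.\<close>

lemma integral_idempotent_mult_eq_inf:
  fixes x y :: "'a::integral_fle_algebra"
  assumes "\<And>z::'a. z \<le> z * z"
  shows "x * y = inf x y"
proof (rule order.antisym)
  show "x * y \<le> inf x y"
    by (simp add: integral_mult_le)
  have "inf x y \<le> inf x y * inf x y"
    by (rule assms)
  also have "\<dots> \<le> x * y"
    by (simp add: fle_mult_mono)
  finally show "inf x y \<le> x * y" .
qed

lemma neg_mult_le:
  fixes x :: "'a::fle_algebra"
  shows "x * \<not>\<^sub>e x \<le> 0"
  using fle_mult_residual_le[of x 0] by (simp add: fle_neg_def mult.commute)

lemma neg_antimono:
  fixes x y :: "'a::fle_algebra"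
  assumes "x \<le> y"
  shows "\<not>\<^sub>e y \<le> \<not>\<^sub>e x"
  unfolding fle_neg_def
  by (meson assms fle_mult_mono fle_mult_residual_le order_refl order_trans residuation)

text \<open>By currying, \<open>z\<close> lies below either side iff
  \<open>z * x * y \<le> 0\<close>.\<close>

lemma residual_neg:
  fixes x y :: "'a::fle_algebra"
  shows "x \<rightarrow>\<^sub>e \<not>\<^sub>e y = \<not>\<^sub>e (x * y)"
proof (rule order.antisym)
  have "z \<le> x \<rightarrow>\<^sub>e \<not>\<^sub>e y \<longleftrightarrow> z \<le> \<not>\<^sub>e (x * y)" for z
    by (simp add: fle_neg_def mult.assoc flip: residuation)
  then show "x \<rightarrow>\<^sub>e \<not>\<^sub>e y \<le> \<not>\<^sub>e (x * y)" and "\<not>\<^sub>e (x * y) \<le> x \<rightarrow>\<^sub>e \<not>\<^sub>e y"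
    by blast+
qed

text \<open>The hypothesis \<open>nilp\<close> is what remains of the first connexive law, stated
  without \<open>imp\<close> and \<open>\<delta>\<close>.\<close>

lemma involutive_boolean:
  fixes x y :: "'a::integral_fle_algebra"
  assumes dn: "\<And>x::'a. \<not>\<^sub>e \<not>\<^sub>e x = x"
    and nilp: "\<And>x::'a. x \<le> \<not>\<^sub>e x \<Longrightarrow> \<not>\<^sub>e x \<rightarrow>\<^sub>e x \<le> 0"
  shows "x * y = inf x y" and "x \<rightarrow>\<^sub>e y = sup (\<not>\<^sub>e x) y"
proof -
  have neg_one: "\<not>\<^sub>e (1::'a) = 0"
    by (simp add: fle_neg_def)
  have bot: "0 \<le> x" for x :: 'a
    using neg_antimono[OF le_one[of "\<not>\<^sub>e x"]] by (simp add: dn neg_one)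
  have compl: "inf x (\<not>\<^sub>e x) = 0" for x :: 'a
  proof -
    define z where "z = inf x (\<not>\<^sub>e x)"
    have "z * z \<le> x * \<not>\<^sub>e x"
      by (simp add: z_def fle_mult_mono)
    then have "z \<le> \<not>\<^sub>e z"
      unfolding fle_neg_def[of z] residuation[symmetric] by (rule order_trans[OF _ neg_mult_le])
    then have "\<not>\<^sub>e z \<rightarrow>\<^sub>e z \<le> 0"
      by (rule nilp)
    moreover have "\<not>\<^sub>e z \<rightarrow>\<^sub>e z = \<not>\<^sub>e (\<not>\<^sub>e z * \<not>\<^sub>e z)"
      using residual_neg[of "\<not>\<^sub>e z" "\<not>\<^sub>e z"] by (simp add: dn)
    ultimately have "\<not>\<^sub>e (\<not>\<^sub>e z * \<not>\<^sub>e z) = 0"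
      using bot by (simp add: order.antisym)
    \<comment> \<open>Negation is injective by \<open>dn\<close>, and \<open>0\<close> is the
      negation of \<open>1\<close>.\<close>
    then have "\<not>\<^sub>e z * \<not>\<^sub>e z = 1"
      using dn neg_one by metis
    then have "\<not>\<^sub>e z = 1"
      using integral_mult_le(1)[of "\<not>\<^sub>e z" "\<not>\<^sub>e z"] by simp
    then show ?thesis
      using dn neg_one z_def by metis
  qed
  have em: "sup x (\<not>\<^sub>e x) = 1" for x :: 'a
  proof -
    \<comment> \<open>De Morgan transfers \<open>compl\<close> to joins.\<close>
    have "\<not>\<^sub>e sup x (\<not>\<^sub>e x) \<le> inf x (\<not>\<^sub>e x)"
      using neg_antimono[of x "sup x (\<not>\<^sub>e x)"] neg_antimono[of "\<not>\<^sub>e x" "sup x (\<not>\<^sub>e x)"]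
      by (simp add: dn)
    then have "\<not>\<^sub>e sup x (\<not>\<^sub>e x) = 0"
      using bot by (simp add: compl order.antisym)
    then show ?thesis
      using dn neg_one by metis
  qed
  \<comment> \<open>Multiply \<open>sup x (\<not>\<^sub>e x) = 1\<close> by \<open>x\<close>: the
    part \<open>x * \<not>\<^sub>e x\<close> lies below \<open>0\<close>, the least element.\<close>
  have "x \<le> x * x" for x :: 'a
    using fle_mult_sup_le[of x x "x * x" "\<not>\<^sub>e x"] order_trans[OF neg_mult_le[of x] bot]
    by (simp add: em)
  then show "x * y = inf x y"
    by (rule integral_idempotent_mult_eq_inf)
  show "x \<rightarrow>\<^sub>e y = sup (\<not>\<^sub>e x) y"
  proof (rule order.antisym)
    \<comment> \<open>Split the residual along \<open>sup x (\<not>\<^sub>e x) = 1\<close>.\<close>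
    have "(x \<rightarrow>\<^sub>e y) * x \<le> sup (\<not>\<^sub>e x) y"
      by (rule order_trans[OF fle_mult_residual_le]) simp
    moreover have "(x \<rightarrow>\<^sub>e y) * \<not>\<^sub>e x \<le> sup (\<not>\<^sub>e x) y"
      by (rule order_trans[OF integral_mult_le(2)]) simp
    ultimately show "x \<rightarrow>\<^sub>e y \<le> sup (\<not>\<^sub>e x) y"
      using fle_mult_sup_le[of "x \<rightarrow>\<^sub>e y" x _ "\<not>\<^sub>e x"] by (simp add: em)
    have "\<not>\<^sub>e x \<le> x \<rightarrow>\<^sub>e y"
      unfolding residuation[symmetric]
      using order_trans[OF neg_mult_le bot] by (simp add: mult.commute)
    moreover have "y \<le> x \<rightarrow>\<^sub>e y"
      by (simp add: integral_mult_le flip: residuation)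
    ultimately show "sup (\<not>\<^sub>e x) y \<le> x \<rightarrow>\<^sub>e y"
      by simp
  qed
qed

text \<open>Makes the Boolean calculus available for the converse. Once products are meets,
  residuation yields distributivity; \<open>x \<rightarrow>\<^sub>e x = 1\<close> yields the
  excluded middle.\<close>

lemma boolean_class:
  assumes inf: "\<And>x y::'a::integral_fle_algebra. x * y = inf x y"
    and res: "\<And>x y::'a. x \<rightarrow>\<^sub>e y = sup (\<not>\<^sub>e x) y"
  shows "class.boolean_algebra (\<lambda>x y::'a. inf x (\<not>\<^sub>e y)) fle_neg inf (\<le>) (<) sup 0 1"
proof unfold_locales
  show bot: "0 \<le> x" for x :: 'a
  proof -
    have "x = sup 0 x"
      using res[of 1 x] by (simp add: fle_neg_def)
    then show ?thesis
      by (metis sup_ge1)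
  qed
  show "x \<le> 1" for x :: 'a
    by (rule le_one)
  show "sup x (inf y z) = inf (sup x y) (sup x z)" for x y z :: 'a
  proof (rule distrib_imp1)
    fix x y z :: 'a
    show "inf x (sup y z) = sup (inf x y) (inf x z)"
      by (rule order.antisym)
        (auto simp: inf intro!: fle_mult_sup_le[of x y _ z, unfolded inf] intro: le_infI2)
  qed
  show "inf x (\<not>\<^sub>e x) = 0" for x :: 'a
    using neg_mult_le[of x] bot by (simp add: inf order.antisym)
  show "sup x (\<not>\<^sub>e x) = 1" for x :: 'a
    using res[of x x] integral_residual_eq_one_iff[of x x] by (simp add: sup_commute)
qed simp

theorem theorem3p24:
  fixes \<delta> :: "'a::integral_fle_algebra \<Rightarrow> 'a"
    and imp :: "'a \<Rightarrow> 'a \<Rightarrow> 'a"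
  assumes increasing: "\<And>x. x \<le> \<delta> x"
    and lower: "\<And>x y. (x \<rightarrow>\<^sub>e y) * (y \<rightarrow>\<^sub>e \<delta> x) \<le> imp x y"
    and upper: "\<And>x y. imp x y \<le> inf (x \<rightarrow>\<^sub>e y) (y \<rightarrow>\<^sub>e \<delta> x)"
  shows "(proto_connexive imp \<and> (\<forall>x y. imp x y = imp y x)) \<longleftrightarrow>
    ((\<forall>x. \<delta> x = \<not>\<^sub>e \<not>\<^sub>e x) \<and>
     (\<forall>x y::'a. x * y = inf x y) \<and>
     (\<forall>x y::'a. x \<rightarrow>\<^sub>e y = sup (\<not>\<^sub>e x) y))"
proof (intro iffI)
  assume "proto_connexive imp \<and> (\<forall>x y. imp x y = imp y x)"
  then have pc: "proto_connexive imp" and sym: "imp x y = imp y x" for x y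
    by auto
  have "\<delta> 1 = 1"
    using increasing[of 1] by simp
  \<comment> \<open>One of the two residuals is \<open>1\<close>, so the lower and upper bounds
    coincide.\<close>
  then have imp_one_left: "imp 1 y = y" for y
    using lower[of 1 y] upper[of 1 y] le_one[of y] integral_residual_eq_one_iff[of y 1]
    by (auto intro: order.antisym)
  have "imp y 1 = \<delta> y" for y
    using lower[of y 1] upper[of y 1] le_one[of y]
      integral_residual_eq_one_iff[of y 1] by (auto intro: order.antisym)
  then have \<delta>_id: "\<delta> y = y" for y
    using imp_one_left sym by metis
  \<comment> \<open>With \<open>\<delta>\<close> the identity, the upper bound contains both
    residuals, so a connexive law of the form \<open>1 \<le> imp a b\<close> becomes an
    equation.\<close>
  have eq_if: "x = y" if "1 \<le> imp x y" for x y
  proof -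
    have "1 \<le> x \<rightarrow>\<^sub>e y" and "1 \<le> y \<rightarrow>\<^sub>e x"
      using order_trans[OF that upper] by (auto simp only: le_inf_iff \<delta>_id)
    then show ?thesis
      by (simp only: one_le_residual_iff order.antisym)
  qed
  have dn: "\<not>\<^sub>e \<not>\<^sub>e x = x" for x :: 'a
  proof -
    have "1 \<le> imp (imp 1 x) (\<not>\<^sub>e (imp 1 (\<not>\<^sub>e x)))"
      using pc unfolding proto_connexive_def by blast
    then show ?thesis
      using eq_if by (simp only: imp_one_left) metis
  qed
  have nilp: "\<not>\<^sub>e x \<rightarrow>\<^sub>e x \<le> 0" if "x \<le> \<not>\<^sub>e x" for x :: 'a
  proof -
    have "1 \<le> \<not>\<^sub>e (imp x (\<not>\<^sub>e x))"
      using pc unfolding proto_connexive_def by blast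
    then have "imp x (\<not>\<^sub>e x) \<le> 0"
      by (simp only: fle_neg_def[of "imp _ _"] one_le_residual_iff)
    \<comment> \<open>As \<open>x \<le> \<not>\<^sub>e x\<close>, the first factor of the lower
      bound is \<open>1\<close>.\<close>
    moreover have "\<not>\<^sub>e x \<rightarrow>\<^sub>e x \<le> imp x (\<not>\<^sub>e x)"
      using lower[of x "\<not>\<^sub>e x"] that
      by (simp add: \<delta>_id integral_residual_eq_one_iff[THEN iffD2])
    ultimately show ?thesis
      by (rule order_trans[rotated])
  qed
  show "(\<forall>x. \<delta> x = \<not>\<^sub>e \<not>\<^sub>e x) \<and> (\<forall>x y::'a. x * y = inf x y) \<and>
    (\<forall>x y::'a. x \<rightarrow>\<^sub>e y = sup (\<not>\<^sub>e x) y)"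
    using involutive_boolean[OF dn nilp] by (simp add: dn \<delta>_id)
next
  assume *: "(\<forall>x. \<delta> x = \<not>\<^sub>e \<not>\<^sub>e x) \<and> (\<forall>x y::'a. x * y = inf x y) \<and>
    (\<forall>x y::'a. x \<rightarrow>\<^sub>e y = sup (\<not>\<^sub>e x) y)"
  interpret B: boolean_algebra "\<lambda>x y::'a. inf x (\<not>\<^sub>e y)" fle_neg inf "(\<le>)" "(<)" sup 0 1
    using * by (intro boolean_class) auto
  \<comment> \<open>The two bounds agree because the product is the meet.\<close>
  have imp_eq: "imp x y = inf (sup (\<not>\<^sub>e x) y) (sup (\<not>\<^sub>e y) x)" for x y
    using lower[of x y] upper[of x y] * by (simp add: order.antisym)
  have imp_refl: "imp x x = 1" for x
    by (simp add: imp_eq)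
  \<comment> \<open>Pulling negations out of the biconditional, with symmetry for the left argument,
    reduces all four laws to \<open>imp_refl\<close>.\<close>
  have imp_neg: "imp x (\<not>\<^sub>e y) = \<not>\<^sub>e (imp x y)" for x y
    by (simp add: imp_eq B.inf_sup_distrib1 B.inf_sup_distrib2 ac_simps)
  have sym: "imp x y = imp y x" for x y
    by (simp add: imp_eq inf_commute)
  have "proto_connexive imp"
    unfolding proto_connexive_def
    by (simp add: imp_neg imp_refl sym[of "\<not>\<^sub>e _" _])
  with sym show "proto_connexive imp \<and> (\<forall>x y. imp x y = imp y x)"
    by blast
qed

end
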